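(* Consider an execution of the Smart-BFT protocol with $n\ge 2f+1$ validators, at most $f$ of which are Byzantine. Let $cp_k'$ be the checkpoint submitted to the contract $\mathbb{C}$ by the leader of epoch $k$, and let $B_k'$ be the block it contains. If a block $B_k$ is committed by all honest validators at epoch $k$, then at epoch $k+1$ the checkpoint $cp_k'$ is either revoked, or settled with $B_k'=B_k$.
   Context: **Setting.** There is a mainchain $\mathbb{MC}$, always available and correct, carrying a set of smart contracts $\mathbb{C}$; every message sent to $\mathbb{C}$ is confirmed within time $\Delta$, and every party can instantaneously read the state of $\mathbb{C}$ (current epoch number $k$, current leader $L_k$, all checkpoints). There are validators $\mathcal V=\{V_1,\dots,V_n\}$, $n\ge 2f+1$, with public keys known to $\mathbb{C}$; at most $f$ are Byzantine (arbitrary behaviour, possible collusion), the rest are honest. The network is synchronous (known bound on message delay). All messages are signed; hash functions are collision resistant and signatures unforgeable, so blocks are identified with hashes of their headers. Broadcasting means sending to all parties including oneself. An aggregate signature scheme combines several signatures into one verifiable signature. **Smart-BFT, epoch $k$.** The leader order is a predetermined rotation recorded in $\mathbb{C}$. (1) Pre-prepare: $L_k$ builds a block $B_k$ on the block committed in epoch $k-1$ and broadcasts it; the others check its validity. (2) Prepare: each party that received a valid block broadcasts a signed prepare message with its hash. A party that sees a prepare message for a different block (equivocation) ends this phase without a certificate; otherwise, if it receives at least $f+1$ prepare messages, all for the block $B_k$ it received, it aggregates them into a quorum certificate $QC_{B_k}$. (3) Commit: a party holding $QC_{B_k}$ broadcasts a signed lock message (also called commit message) carrying $B_k$ and $QC_{B_k}$.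 A party receiving a lock message with a correct $QC_{B_k}$ commits $B_k$. If the leader receives at least $f+1$ lock messages for the block it proposed, it aggregates their signatures into a new quorum certificate. (4) Submit: the leader submits to $\mathbb{C}$ the hash of $B_k$ with this certificate. $\mathbb{C}$ records it as checkpoint $cp_k$ ("containing" $B_k$), advances to epoch $k+1$ and changes the leader. A checkpoint is valid iff its quorum certificate is a correct aggregate of signatures of at least $f+1$ distinct validators on lock messages for its block; otherwise it is faulty (invalid). **Consensus core.** The consensus core is that of Synchronous Byzantine Agreement, unmodified, and has these properties. Agreement: if two honest validators commit $B_k$ and $B_k'$ in epoch $k$, then $B_k=B_k'$. Termination: if the leader $L_k$ is honest, every honest party commits by the end of epoch $k$. **Challenges and checkpoint status.** The newly confirmed $cp_k$ is *unsettled*. Its challenge period runs until $\mathbb{C}$ confirms the next checkpoint. During epoch $k+1$, honest validators check $cp_k$ and send a challenge to $\mathbb{C}$ if it is incorrect. On a challenge, $\mathbb{C}$ verifies the quorum certificate of $cp_k$; if it is incorrect, $cp_k$ is *revoked* ($cp_k:=\bot$) and its leader is slashed (removed from $\mathcal V$). If $cp_k$ is not successfully challenged, it becomes *settled* when the next checkpoint comes. **Timeout.** $\mathbb{C}$ has a timer, reset at each confirmed submission. If it expires with no submission, any party may send a challenge, upon which $\mathbb{C}$ performs a view-change: it resets the timer, selects a new leader, increments the epoch number, marks the previous (unrevoked) checkpoint settled and sets the current epoch's checkpoint to $\bot$.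
   Formalization: Added: after a faulty checkpoint, epoch k+1 lasts at least the checking time plus Δ (else a quick next submission settles it before a challenge is confirmed); and once the timer expires, some party does send the timeout challenge (else epoch k+1 may never end). *)

theory Defs
  imports Main
begin

text \<open>
  Executions of Smart-BFT are timed: a tick is a natural number, all delays are counted in ticks.
  Parties are elements of \<open>'p\<close>, blocks (identified with the hashes of their headers) elements of
  \<open>'b\<close>, signatures and aggregate signatures elements of \<open>'s\<close>.
  The first argument of every constructor of \<open>body\<close> is the epoch; that it is part of what is signed
  keeps a certificate of one epoch from being presented again in another.
\<close>

datatype 'b body = Propose nat 'b | Prepare nat 'b | Lock nat 'b

record ('p, 's) cert =
  signers :: "'p set"
  agg :: 's

text \<open>The last component is the certificate that a lock message carries with it.\<close>

datatype ('p, 'b, 's) msg =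
  Msg (sender: 'p) (body: "'b body") (sig: 's) (carried: "('p, 's) cert option")

text \<open>
  Messages to the contract. \<open>Challenge k\<close> disputes the checkpoint of epoch \<open>k\<close>; \<open>Timeout\<close> is the
  challenge that asks for a view-change.
\<close>

datatype ('p, 'b, 's) cmsg = Submit nat 'b "('p, 's) cert" | Challenge nat | Timeout

record ('p, 'b, 's) params =
  rotation :: "'p list"
  faults :: nat
  confirm_delay :: nat
  net_delay :: nat
  check_delay :: nat
  timeout :: nat
  verify :: "'p \<Rightarrow> 'b body \<Rightarrow> 's \<Rightarrow> bool"
  aggregate :: "('p \<times> 's) set \<Rightarrow> 's"
  valid_block :: "'b \<Rightarrow> bool"
  parent :: "'b \<Rightarrow> 'b"

abbreviation validators :: "('p, 'b, 's) params \<Rightarrow> 'p set" where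
  "validators P \<equiv> set (rotation P)"

definition correct_aggregate ::
    "('p, 'b, 's) params \<Rightarrow> 'p set \<Rightarrow> 'b body \<Rightarrow> 's \<Rightarrow> bool" where
  "correct_aggregate P V x a \<longleftrightarrow>
     (\<exists>\<sigma>. (\<forall>v\<in>V. verify P v x (\<sigma> v)) \<and> a = aggregate P ((\<lambda>v. (v, \<sigma> v)) ` V))"

definition quorum_cert ::
    "('p, 'b, 's) params \<Rightarrow> 'p set \<Rightarrow> 'b body \<Rightarrow> ('p, 's) cert \<Rightarrow> bool" where
  "quorum_cert P V x c \<longleftrightarrow>
     signers c \<subseteq> V \<and> faults P + 1 \<le> card (signers c) \<and> correct_aggregate P (signers c) x (agg c)"


section \<open>The contract\<close>

record ('p, 'b, 's) checkpoint =
  cp_block :: 'b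
  cp_cert :: "('p, 's) cert"
  cp_leader :: 'p

datatype status = Absent | Unsettled | Settled | Revoked

text \<open>
  \<open>order\<close> lists the validators that have not been slashed, the current leader first.
  \<open>members k\<close> is the validator set on record when epoch \<open>k\<close> opens: the certificates of epoch \<open>k\<close> are
  checked against it, so a validator slashed during epoch \<open>k\<close> is left out from epoch \<open>k + 1\<close> on.
  \<open>checkpoints k = None\<close> renders the value bottom of the checkpoint of epoch \<open>k\<close>.
\<close>

record ('p, 'b, 's) contract =
  epoch :: nat
  order :: "'p list"
  members :: "nat \<Rightarrow> 'p set"
  checkpoints :: "nat \<Rightarrow> ('p, 'b, 's) checkpoint option"
  statuses :: "nat \<Rightarrow> status"
  timer_reset :: nat

abbreviation leader :: "('p, 'b, 's) contract \<Rightarrow> 'p" where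
  "leader S \<equiv> hd (order S)"

definition valid_checkpoint ::
    "('p, 'b, 's) params \<Rightarrow> ('p, 'b, 's) contract \<Rightarrow> nat \<Rightarrow> ('p, 'b, 's) checkpoint \<Rightarrow> bool" where
  "valid_checkpoint P S k cp \<longleftrightarrow> quorum_cert P (members S k) (Lock k (cp_block cp)) (cp_cert cp)"

definition faulty_at ::
    "('p, 'b, 's) params \<Rightarrow> ('p, 'b, 's) contract \<Rightarrow> nat \<Rightarrow> bool" where
  "faulty_at P S k \<longleftrightarrow> (\<exists>cp. checkpoints S k = Some cp \<and> \<not> valid_checkpoint P S k cp)"

definition initial_contract :: "('p, 'b, 's) params \<Rightarrow> ('p, 'b, 's) contract" where
  "initial_contract P =
     \<lparr>epoch = 1, order = rotation P, members = (\<lambda>_. validators P), checkpoints = (\<lambda>_. None),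
      statuses = (\<lambda>_. Absent), timer_reset = 0\<rparr>"

definition timer_expired ::
    "('p, 'b, 's) params \<Rightarrow> nat \<Rightarrow> ('p, 'b, 's) contract \<Rightarrow> bool" where
  "timer_expired P t S \<longleftrightarrow> timer_reset S + timeout P \<le> t"

text \<open>
  Closing the current epoch \<open>k\<close> at tick \<open>t\<close>, leaving \<open>cp\<close> (possibly bottom) as its checkpoint:
  the checkpoint of epoch \<open>k - 1\<close> becomes settled unless it was revoked.
\<close>

definition next_epoch ::
    "nat \<Rightarrow> ('p, 'b, 's) checkpoint option \<Rightarrow> ('p, 'b, 's) contract \<Rightarrow> ('p, 'b, 's) contract" where
  "next_epoch t cp S =
     (let k = epoch S; st = statuses S; ord = rotate1 (order S) in
      \<lparr>epoch = k + 1,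
       order = ord,
       members = (members S)(k + 1 := set ord),
       checkpoints = (checkpoints S)(k := cp),
       statuses = (if st (k - 1) = Unsettled then st(k - 1 := Settled) else st)
                    (k := (if cp = None then Absent else Unsettled)),
       timer_reset = t\<rparr>)"

definition revoke ::
    "nat \<Rightarrow> ('p, 'b, 's) checkpoint \<Rightarrow> ('p, 'b, 's) contract \<Rightarrow> ('p, 'b, 's) contract" where
  "revoke k cp S =
     S\<lparr>checkpoints := (checkpoints S)(k := None),
       statuses := (statuses S)(k := Revoked),
       order := filter (\<lambda>v. v \<noteq> cp_leader cp) (order S)\<rparr>"

fun contract_step ::
    "('p, 'b, 's) params \<Rightarrow> nat \<Rightarrow> 'p \<times> ('p, 'b, 's) cmsg \<Rightarrow>
     ('p, 'b, 's) contract \<Rightarrow> ('p, 'b, 's) contract" where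
  "contract_step P t (p, Submit k B c) S =
     (if k = epoch S \<and> p = leader S
      then next_epoch t (Some \<lparr>cp_block = B, cp_cert = c, cp_leader = p\<rparr>) S else S)"
| "contract_step P t (p, Challenge k) S =
     (if epoch S = k + 1 \<and> statuses S k = Unsettled \<and> faulty_at P S k
      then revoke k (the (checkpoints S k)) S else S)"
| "contract_step P t (p, Timeout) S =
     (if timer_expired P t S then next_epoch t None S else S)"


section \<open>Executions\<close>

text \<open>
  \<open>sends X t p q m\<close>: \<open>p\<close> sends \<open>m\<close> to \<open>q\<close>. \<open>receives X t q m\<close>: \<open>m\<close> is delivered to \<open>q\<close>.
  \<open>commits X t p k B\<close>: \<open>p\<close> commits \<open>B\<close> as the block of epoch \<open>k\<close>.
  \<open>csends X t p a\<close>: \<open>p\<close> sends \<open>a\<close> to the contract. \<open>confirmed X t\<close>: the messages that the mainchain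
  confirms at tick \<open>t\<close>, with their senders, in the order in which the contract executes them.
\<close>

record ('p, 'b, 's) execution =
  byzantine :: "'p set"
  sends :: "nat \<Rightarrow> 'p \<Rightarrow> 'p \<Rightarrow> ('p, 'b, 's) msg \<Rightarrow> bool"
  receives :: "nat \<Rightarrow> 'p \<Rightarrow> ('p, 'b, 's) msg \<Rightarrow> bool"
  commits :: "nat \<Rightarrow> 'p \<Rightarrow> nat \<Rightarrow> 'b \<Rightarrow> bool"
  csends :: "nat \<Rightarrow> 'p \<Rightarrow> ('p, 'b, 's) cmsg \<Rightarrow> bool"
  confirmed :: "nat \<Rightarrow> ('p \<times> ('p, 'b, 's) cmsg) list"

definition honest :: "('p, 'b, 's) params \<Rightarrow> ('p, 'b, 's) execution \<Rightarrow> 'p set" where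
  "honest P X = validators P - byzantine X"

primrec contract_before ::
    "('p, 'b, 's) params \<Rightarrow> ('p, 'b, 's) execution \<Rightarrow> nat \<Rightarrow> ('p, 'b, 's) contract" where
  "contract_before P X 0 = initial_contract P"
| "contract_before P X (Suc t) = fold (contract_step P t) (confirmed X t) (contract_before P X t)"

text \<open>What every party reads from the contract at tick \<open>t\<close>.\<close>

definition contract_at ::
    "('p, 'b, 's) params \<Rightarrow> ('p, 'b, 's) execution \<Rightarrow> nat \<Rightarrow> ('p, 'b, 's) contract" where
  "contract_at P X t = contract_before P X (Suc t)"

text \<open>The state in which the contract executes the \<open>i\<close>-th message confirmed at tick \<open>t\<close>.\<close>

definition contract_within ::
    "('p, 'b, 's) params \<Rightarrow> ('p, 'b, 's) execution \<Rightarrow> nat \<Rightarrow> nat \<Rightarrow> ('p, 'b, 's) contract" where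
  "contract_within P X t i =
     fold (contract_step P t) (take i (confirmed X t)) (contract_before P X t)"

abbreviation epoch_at :: "('p, 'b, 's) params \<Rightarrow> ('p, 'b, 's) execution \<Rightarrow> nat \<Rightarrow> nat" where
  "epoch_at P X t \<equiv> epoch (contract_at P X t)"

definition opens_at ::
    "('p, 'b, 's) params \<Rightarrow> ('p, 'b, 's) execution \<Rightarrow> nat \<Rightarrow> nat \<Rightarrow> bool" where
  "opens_at P X k t \<longleftrightarrow> k \<le> epoch_at P X t \<and> (\<forall>t'<t. epoch_at P X t' < k)"

definition ends_at ::
    "('p, 'b, 's) params \<Rightarrow> ('p, 'b, 's) execution \<Rightarrow> nat \<Rightarrow> nat \<Rightarrow> bool" where
  "ends_at P X k t \<longleftrightarrow> opens_at P X (k + 1) t"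

text \<open>The checkpoint that the leader of epoch \<open>k\<close> submits and the contract records.\<close>

definition submitted ::
    "('p, 'b, 's) params \<Rightarrow> ('p, 'b, 's) execution \<Rightarrow> nat \<Rightarrow> ('p, 'b, 's) checkpoint \<Rightarrow> bool" where
  "submitted P X k cp \<longleftrightarrow>
     (\<exists>t i. i < length (confirmed X t) \<and>
        confirmed X t ! i = (cp_leader cp, Submit k (cp_block cp) (cp_cert cp)) \<and>
        epoch (contract_within P X t i) = k \<and> leader (contract_within P X t i) = cp_leader cp)"

definition revoked_at ::
    "('p, 'b, 's) params \<Rightarrow> ('p, 'b, 's) execution \<Rightarrow> nat \<Rightarrow> nat \<Rightarrow> bool" where
  "revoked_at P X t k \<longleftrightarrow>
     statuses (contract_at P X t) k = Revoked \<and> checkpoints (contract_at P X t) k = None"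

definition settled_at ::
    "('p, 'b, 's) params \<Rightarrow> ('p, 'b, 's) execution \<Rightarrow> nat \<Rightarrow> nat \<Rightarrow> ('p, 'b, 's) checkpoint \<Rightarrow> bool" where
  "settled_at P X t k cp \<longleftrightarrow>
     statuses (contract_at P X t) k = Settled \<and> checkpoints (contract_at P X t) k = Some cp"


subsection \<open>Mainchain, network, signatures\<close>

text \<open>
  What is read at tick \<open>t\<close> reflects everything confirmed at tick \<open>t\<close>, so a message sent at \<open>t\<close> is
  confirmed at a later tick.
\<close>

definition mainchain_live :: "('p, 'b, 's) params \<Rightarrow> ('p, 'b, 's) execution \<Rightarrow> bool" where
  "mainchain_live P X \<longleftrightarrow>
     (\<forall>t p a. csends X t p a \<longrightarrow>
        (\<exists>t'. t < t' \<and> t' \<le> t + confirm_delay P \<and> (p, a) \<in> set (confirmed X t'))) \<and>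
     (\<forall>t p a. (p, a) \<in> set (confirmed X t) \<longrightarrow> (\<exists>t'<t. csends X t' p a))"

definition synchronous_network :: "('p, 'b, 's) params \<Rightarrow> ('p, 'b, 's) execution \<Rightarrow> bool" where
  "synchronous_network P X \<longleftrightarrow>
     (\<forall>t p. \<forall>q\<in>validators P. \<forall>m. sends X t p q m \<longrightarrow>
        (\<exists>t'. t \<le> t' \<and> t' \<le> t + net_delay P \<and> receives X t' q m)) \<and>
     (\<forall>t q m. receives X t q m \<longrightarrow> (\<exists>t'\<le>t. \<exists>p. sends X t' p q m))"

definition authentic :: "('p, 'b, 's) params \<Rightarrow> ('p, 'b, 's) msg \<Rightarrow> bool" where
  "authentic P m \<longleftrightarrow> verify P (sender m) (body m) (sig m)"

text \<open>Honest parties only broadcast, to all validators including themselves.\<close>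

definition honest_broadcast :: "('p, 'b, 's) params \<Rightarrow> ('p, 'b, 's) execution \<Rightarrow> bool" where
  "honest_broadcast P X \<longleftrightarrow>
     (\<forall>t. \<forall>p\<in>honest P X. \<forall>q m. sends X t p q m \<longrightarrow>
        sender m = p \<and> authentic P m \<and> (\<forall>q'\<in>validators P. sends X t p q' m))"

definition says :: "('p, 'b, 's) execution \<Rightarrow> nat \<Rightarrow> 'p \<Rightarrow> 'b body \<Rightarrow> bool" where
  "says X t p x \<longleftrightarrow> (\<exists>q m. sends X t p q m \<and> body m = x)"

text \<open>
  \<open>verify\<close> and \<open>correct_aggregate\<close> are predicates on data, so unforgeability is a property of the
  signatures that actually occur in the execution: those of honest validators were produced by them.
\<close>

definition unforgeable :: "('p, 'b, 's) params \<Rightarrow> ('p, 'b, 's) execution \<Rightarrow> bool" where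
  "unforgeable P X \<longleftrightarrow>
     (\<forall>t p q m. sends X t p q m \<longrightarrow>
        (sender m \<in> honest P X \<and> authentic P m \<longrightarrow> (\<exists>t'\<le>t. says X t' (sender m) (body m))) \<and>
        (\<forall>c x. carried m = Some c \<and> correct_aggregate P (signers c) x (agg c) \<longrightarrow>
           (\<forall>v\<in>signers c \<inter> honest P X. \<exists>t'\<le>t. says X t' v x))) \<and>
     (\<forall>t p k B c x. csends X t p (Submit k B c) \<and> correct_aggregate P (signers c) x (agg c) \<longrightarrow>
        (\<forall>v\<in>signers c \<inter> honest P X. \<exists>t'\<le>t. says X t' v x))"

definition hears ::
    "('p, 'b, 's) params \<Rightarrow> ('p, 'b, 's) execution \<Rightarrow> nat \<Rightarrow> 'p \<Rightarrow> 'p \<Rightarrow> 'b body \<Rightarrow> bool" where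
  "hears P X t p v x \<longleftrightarrow>
     (\<exists>t'\<le>t. \<exists>m. receives X t' p m \<and> authentic P m \<and> sender m = v \<and> body m = x)"

text \<open>By tick \<open>t\<close>, \<open>p\<close> can aggregate \<open>c\<close> from the messages with body \<open>x\<close> it received from \<open>V\<close>.\<close>

definition collected ::
    "('p, 'b, 's) params \<Rightarrow> ('p, 'b, 's) execution \<Rightarrow> nat \<Rightarrow> 'p \<Rightarrow> 'p set \<Rightarrow> 'b body \<Rightarrow>
     ('p, 's) cert \<Rightarrow> bool" where
  "collected P X t p V x c \<longleftrightarrow>
     signers c \<subseteq> V \<and> faults P + 1 \<le> card (signers c) \<and>
     (\<exists>\<sigma>. (\<forall>v\<in>signers c. \<exists>t'\<le>t. \<exists>m. receives X t' p m \<and> authentic P m \<and>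
                  sender m = v \<and> body m = x \<and> sig m = \<sigma> v) \<and>
          agg c = aggregate P ((\<lambda>v. (v, \<sigma> v)) ` signers c))"


subsection \<open>Honest behaviour\<close>

text \<open>
  Each rule has a part saying when an honest party may act and a part saying when it has to. The
  lengths of the phases are left open: an action that is due is taken eventually, unless the epoch
  is over before.
\<close>

definition due ::
    "('p, 'b, 's) params \<Rightarrow> ('p, 'b, 's) execution \<Rightarrow> nat \<Rightarrow> nat \<Rightarrow> (nat \<Rightarrow> bool) \<Rightarrow> bool" where
  "due P X k t Q \<longleftrightarrow> (\<exists>t'\<ge>t. Q t' \<or> k < epoch_at P X t')"

definition pre_prepare_rule :: "('p, 'b, 's) params \<Rightarrow> ('p, 'b, 's) execution \<Rightarrow> bool" where
  "pre_prepare_rule P X \<longleftrightarrow>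
     (\<forall>p\<in>honest P X. \<forall>k.
        (\<forall>t B. says X t p (Propose k B) \<longrightarrow>
           epoch_at P X t = k \<and> leader (contract_at P X t) = p \<and> valid_block P B \<and>
           (\<forall>t' B'. t' \<le> t \<and> commits X t' p (k - 1) B' \<longrightarrow> parent P B = B')) \<and>
        (\<forall>t t' B B'. says X t p (Propose k B) \<and> says X t' p (Propose k B') \<longrightarrow> B = B') \<and>
        (\<forall>t. epoch_at P X t = k \<and> leader (contract_at P X t) = p \<longrightarrow>
           due P X k t (\<lambda>_. \<exists>s B. says X s p (Propose k B))))"

text \<open>By tick \<open>t\<close> of epoch \<open>k\<close>, \<open>p\<close> has received the valid block \<open>B\<close> from the leader.\<close>

definition got_block ::
    "('p, 'b, 's) params \<Rightarrow> ('p, 'b, 's) execution \<Rightarrow> nat \<Rightarrow> 'p \<Rightarrow> nat \<Rightarrow> 'b \<Rightarrow> bool" where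
  "got_block P X t p k B \<longleftrightarrow>
     epoch_at P X t = k \<and> hears P X t p (leader (contract_at P X t)) (Propose k B) \<and>
     valid_block P B"

definition prepare_rule :: "('p, 'b, 's) params \<Rightarrow> ('p, 'b, 's) execution \<Rightarrow> bool" where
  "prepare_rule P X \<longleftrightarrow>
     (\<forall>p\<in>honest P X. \<forall>k.
        (\<forall>t B. says X t p (Prepare k B) \<longrightarrow> got_block P X t p k B) \<and>
        (\<forall>t t' B B'. says X t p (Prepare k B) \<and> says X t' p (Prepare k B') \<longrightarrow> B = B') \<and>
        (\<forall>t B. got_block P X t p k B \<longrightarrow>
           due P X k t (\<lambda>_. \<exists>s B'. says X s p (Prepare k B'))))"

definition sees_equivocation ::
    "('p, 'b, 's) params \<Rightarrow> ('p, 'b, 's) execution \<Rightarrow> nat \<Rightarrow> 'p \<Rightarrow> nat \<Rightarrow> 'b \<Rightarrow> bool" where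
  "sees_equivocation P X t p k B \<longleftrightarrow>
     (\<exists>v\<in>members (contract_at P X t) k. \<exists>B'. B' \<noteq> B \<and> hears P X t p v (Prepare k B'))"

definition holds_qc ::
    "('p, 'b, 's) params \<Rightarrow> ('p, 'b, 's) execution \<Rightarrow> nat \<Rightarrow> 'p \<Rightarrow> nat \<Rightarrow> 'b \<Rightarrow>
     ('p, 's) cert \<Rightarrow> bool" where
  "holds_qc P X t p k B c \<longleftrightarrow>
     p \<in> members (contract_at P X t) k \<and> got_block P X t p k B \<and>
     collected P X t p (members (contract_at P X t) k) (Prepare k B) c \<and>
     \<not> sees_equivocation P X t p k B"

definition lock_rule :: "('p, 'b, 's) params \<Rightarrow> ('p, 'b, 's) execution \<Rightarrow> bool" where
  "lock_rule P X \<longleftrightarrow>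
     (\<forall>p\<in>honest P X. \<forall>k B.
        (\<forall>t q m. sends X t p q m \<and> body m = Lock k B \<longrightarrow>
           (\<exists>c. carried m = Some c \<and> holds_qc P X t p k B c)) \<and>
        (\<forall>t c. holds_qc P X t p k B c \<longrightarrow>
           due P X k t (\<lambda>t'. (\<exists>s. says X s p (Lock k B)) \<or> sees_equivocation P X t' p k B)))"

definition correct_lock ::
    "('p, 'b, 's) params \<Rightarrow> ('p, 'b, 's) contract \<Rightarrow> nat \<Rightarrow> 'b \<Rightarrow> ('p, 'b, 's) msg \<Rightarrow> bool" where
  "correct_lock P S k B m \<longleftrightarrow>
     k \<le> epoch S \<and> authentic P m \<and> sender m \<in> members S k \<and> body m = Lock k B \<and>
     (\<exists>c. carried m = Some c \<and> quorum_cert P (members S k) (Prepare k B) c)"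

definition commit_rule :: "('p, 'b, 's) params \<Rightarrow> ('p, 'b, 's) execution \<Rightarrow> bool" where
  "commit_rule P X \<longleftrightarrow>
     (\<forall>p\<in>honest P X. \<forall>k B.
        (\<forall>t. commits X t p k B \<longrightarrow>
           (\<exists>t'\<le>t. \<exists>m. receives X t' p m \<and> correct_lock P (contract_at P X t') k B m)) \<and>
        (\<forall>t m. receives X t p m \<and> correct_lock P (contract_at P X t) k B m \<longrightarrow>
           commits X t p k B))"

definition submit_ready ::
    "('p, 'b, 's) params \<Rightarrow> ('p, 'b, 's) execution \<Rightarrow> nat \<Rightarrow> 'p \<Rightarrow> nat \<Rightarrow> 'b \<Rightarrow>
     ('p, 's) cert \<Rightarrow> bool" where
  "submit_ready P X t p k B c \<longleftrightarrow>
     epoch_at P X t = k \<and> leader (contract_at P X t) = p \<and>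
     (\<exists>t'\<le>t. says X t' p (Propose k B)) \<and>
     collected P X t p (members (contract_at P X t) k) (Lock k B) c"

definition submit_rule :: "('p, 'b, 's) params \<Rightarrow> ('p, 'b, 's) execution \<Rightarrow> bool" where
  "submit_rule P X \<longleftrightarrow>
     (\<forall>p\<in>honest P X. \<forall>k B.
        (\<forall>t c. csends X t p (Submit k B c) \<longrightarrow> submit_ready P X t p k B c) \<and>
        (\<forall>t c. submit_ready P X t p k B c \<longrightarrow>
           due P X k t (\<lambda>_. \<exists>s c'. csends X s p (Submit k B c'))))"

text \<open>
  An honest validator reads the checkpoint of epoch \<open>k\<close> when epoch \<open>k + 1\<close> opens and takes at most
  \<open>check_delay\<close> ticks to check it; the challenge may be dropped if the checkpoint has meanwhile
  ceased to be unsettled.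
\<close>

definition challenge_rule :: "('p, 'b, 's) params \<Rightarrow> ('p, 'b, 's) execution \<Rightarrow> bool" where
  "challenge_rule P X \<longleftrightarrow>
     (\<forall>p\<in>honest P X. \<forall>k.
        (\<forall>t. csends X t p (Challenge k) \<longrightarrow>
           epoch_at P X t = k + 1 \<and> faulty_at P (contract_at P X t) k) \<and>
        (\<forall>t. opens_at P X (k + 1) t \<and> faulty_at P (contract_at P X t) k \<longrightarrow>
           (\<exists>t'. t \<le> t' \<and> t' \<le> t + check_delay P \<and>
              (csends X t' p (Challenge k) \<or> statuses (contract_at P X t') k \<noteq> Unsettled))))"

text \<open>
  The challenge period of a faulty checkpoint leaves room for checking it and having a challenge
  confirmed. Without this, two consecutive Byzantine leaders could have a faulty checkpoint settled
  by a second submission that is confirmed before any challenge.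
\<close>

definition challenge_period_adequate :: "('p, 'b, 's) params \<Rightarrow> ('p, 'b, 's) execution \<Rightarrow> bool" where
  "challenge_period_adequate P X \<longleftrightarrow>
     (\<forall>k t. opens_at P X (k + 1) t \<and> faulty_at P (contract_at P X t) k \<longrightarrow>
        epoch_at P X (t + check_delay P + confirm_delay P) = k + 1)"

text \<open>Any party may ask for the view-change once the timer has expired; some party does.\<close>

definition timeout_rule :: "('p, 'b, 's) params \<Rightarrow> ('p, 'b, 's) execution \<Rightarrow> bool" where
  "timeout_rule P X \<longleftrightarrow>
     (\<forall>t. timer_expired P t (contract_at P X t) \<longrightarrow>
        due P X (epoch_at P X t) t (\<lambda>t'. \<exists>p. csends X t' p Timeout))"


subsection \<open>Properties of the consensus core\<close>

definition core_agreement :: "('p, 'b, 's) params \<Rightarrow> ('p, 'b, 's) execution \<Rightarrow> bool" where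
  "core_agreement P X \<longleftrightarrow>
     (\<forall>p\<in>honest P X. \<forall>p'\<in>honest P X. \<forall>k t t' B B'.
        commits X t p k B \<and> commits X t' p' k B' \<longrightarrow> B = B')"

definition core_termination :: "('p, 'b, 's) params \<Rightarrow> ('p, 'b, 's) execution \<Rightarrow> bool" where
  "core_termination P X \<longleftrightarrow>
     (\<forall>k s t. epoch_at P X s = k \<and> leader (contract_at P X s) \<in> honest P X \<and> ends_at P X k t \<longrightarrow>
        (\<forall>p\<in>honest P X. \<exists>t'\<le>t. \<exists>B. commits X t' p k B))"

definition smart_bft_execution :: "('p, 'b, 's) params \<Rightarrow> ('p, 'b, 's) execution \<Rightarrow> bool" where
  "smart_bft_execution P X \<longleftrightarrow>
     distinct (rotation P) \<and> byzantine X \<subseteq> validators P \<and>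
     mainchain_live P X \<and> synchronous_network P X \<and> honest_broadcast P X \<and> unforgeable P X \<and>
     pre_prepare_rule P X \<and> prepare_rule P X \<and> lock_rule P X \<and> commit_rule P X \<and>
     submit_rule P X \<and> challenge_rule P X \<and> challenge_period_adequate P X \<and> timeout_rule P X \<and>
     core_agreement P X \<and> core_termination P X"

end

theory Submission
  imports Defs
begin

text \<open>
  Once recorded, the checkpoint of epoch \<open>k\<close> can only be revoked or become settled with its content
  unchanged, and a timeout guarantees that epoch \<open>k + 1\<close> ends. A faulty checkpoint draws a challenge
  from some honest validator, which the challenge period leaves time to confirm. The certificate of
  a valid one has at least \<open>f + 1\<close> signers, one of them honest; that signer broadcast a lock message,
  also to itself, and therefore committed the block of the checkpoint. By agreement this is the block
  that all honest validators commit.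
\<close>

section \<open>Evolution of the contract\<close>

definition recorded ::
    "nat \<Rightarrow> ('p, 'b, 's) checkpoint \<Rightarrow> ('p, 'b, 's) contract \<Rightarrow> bool" where
  "recorded k cp S \<longleftrightarrow> k < epoch S \<and> checkpoints S k = Some cp \<and>
     statuses S k = (if epoch S = k + 1 then Unsettled else Settled)"

definition withdrawn :: "nat \<Rightarrow> ('p, 'b, 's) contract \<Rightarrow> bool" where
  "withdrawn k S \<longleftrightarrow> k < epoch S \<and> checkpoints S k = None \<and> statuses S k = Revoked"

definition evolves :: "('p, 'b, 's) contract \<Rightarrow> ('p, 'b, 's) contract \<Rightarrow> bool" where
  "evolves S S' \<longleftrightarrow>
     epoch S \<le> epoch S' \<and>
     (epoch S' = epoch S \<longrightarrow> timer_reset S' = timer_reset S) \<and>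
     (\<forall>k\<le>epoch S. members S' k = members S k) \<and>
     (\<forall>k. withdrawn k S \<longrightarrow> withdrawn k S') \<and>
     (\<forall>k cp. recorded k cp S \<longrightarrow> recorded k cp S' \<or> withdrawn k S')"

lemma evolves_refl [simp]: "evolves S S"
  by (simp add: evolves_def)

lemma evolves_trans:
  assumes "evolves S S'" and "evolves S' S''"
  shows "evolves S S''"
proof -
  have "epoch S \<le> epoch S'" "epoch S' \<le> epoch S''"
    using assms by (simp_all add: evolves_def)
  moreover have "timer_reset S'' = timer_reset S" if "epoch S'' = epoch S"
  proof -
    have "epoch S' = epoch S" "epoch S'' = epoch S'"
      using that calculation by simp_all
    then show ?thesis
      using assms by (simp add: evolves_def)
  qed
  moreover have "\<forall>k\<le>epoch S. members S'' k = members S k"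
    using assms calculation(1) by (simp add: evolves_def)
  moreover have "\<forall>k. withdrawn k S \<longrightarrow> withdrawn k S''"
    and "\<forall>k cp. recorded k cp S \<longrightarrow> recorded k cp S'' \<or> withdrawn k S''"
    using assms unfolding evolves_def by blast+
  ultimately show ?thesis
    by (auto simp: evolves_def)
qed

lemma evolves_epoch: "evolves S S' \<Longrightarrow> epoch S \<le> epoch S'"
  by (simp add: evolves_def)

lemma evolves_members: "evolves S S' \<Longrightarrow> k \<le> epoch S \<Longrightarrow> members S' k = members S k"
  by (simp add: evolves_def)

lemma evolves_timer:
  "evolves S S' \<Longrightarrow> epoch S' = epoch S \<Longrightarrow> timer_reset S' = timer_reset S"
  by (simp add: evolves_def)

lemma evolves_withdrawn: "evolves S S' \<Longrightarrow> withdrawn k S \<Longrightarrow> withdrawn k S'"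
  by (simp add: evolves_def)

lemma evolves_recorded:
  "evolves S S' \<Longrightarrow> recorded k cp S \<Longrightarrow> recorded k cp S' \<or> withdrawn k S'"
  by (simp add: evolves_def)

lemma evolves_next_epoch: "evolves S (next_epoch t cp S)"
  by (auto simp: evolves_def next_epoch_def Let_def recorded_def withdrawn_def)

lemma evolves_revoke: "epoch S = k + 1 \<Longrightarrow> evolves S (revoke k cp S)"
  by (auto simp: evolves_def revoke_def recorded_def withdrawn_def)

lemma evolves_contract_step: "evolves S (contract_step P t a S)"
  by (cases "(P, t, a, S)" rule: contract_step.cases)
    (auto simp: evolves_next_epoch evolves_revoke)

lemma evolves_fold: "evolves S (fold (contract_step P t) as S)"
  by (induction as arbitrary: S) (auto intro: evolves_trans evolves_contract_step)

lemma evolves_contract_at: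
  assumes "t \<le> t'"
  shows "evolves (contract_at P X t) (contract_at P X t')"
  using assms
proof (induction t' rule: dec_induct)
  case (step u)
  moreover have "evolves (contract_at P X u) (contract_at P X (Suc u))"
    by (simp add: contract_at_def evolves_fold del: fold.simps)
  ultimately show ?case
    by (blast intro: evolves_trans)
qed simp

lemma epoch_at_mono: "t \<le> t' \<Longrightarrow> epoch_at P X t \<le> epoch_at P X t'"
  by (rule evolves_epoch[OF evolves_contract_at])

lemma nth_confirmed_executed:
  assumes "i < length (confirmed X t)"
  shows "evolves (contract_step P t (confirmed X t ! i) (contract_within P X t i)) (contract_at P X t)"
proof -
  have "confirmed X t = take i (confirmed X t) @ confirmed X t ! i # drop (Suc i) (confirmed X t)"
    using assms by (rule id_take_nth_drop)
  then have "contract_at P X t = fold (contract_step P t) (drop (Suc i) (confirmed X t))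
      (contract_step P t (confirmed X t ! i) (contract_within P X t i))"
    unfolding contract_at_def contract_within_def
    by (metis (no_types, lifting) comp_apply contract_before.simps(2) fold_append fold_simps(2))
  then show ?thesis
    by (simp add: evolves_fold)
qed

lemma contract_at_evolves_within:
  assumes "s < t"
  shows "evolves (contract_at P X s) (contract_within P X t i)"
proof -
  obtain u where u: "t = Suc u"
    using assms by (cases t) simp_all
  then have "s \<le> u"
    using assms by simp
  have "evolves (contract_at P X u) (contract_within P X t i)"
    by (simp add: u contract_at_def contract_within_def evolves_fold del: contract_before.simps)
  then show ?thesis
    using evolves_trans evolves_contract_at[OF \<open>s \<le> u\<close>] by blast
qed

lemma confirmed_executed:
  assumes "a \<in> set (confirmed X t)" and "s < t"
  obtains S where "evolves (contract_at P X s) S"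
    and "evolves (contract_step P t a S) (contract_at P X t)"
proof -
  obtain i where i: "i < length (confirmed X t)" "confirmed X t ! i = a"
    using assms(1) by (auto simp: in_set_conv_nth)
  then show thesis
    using that nth_confirmed_executed contract_at_evolves_within[OF assms(2)] by blast
qed

lemma contract_step_validators:
  assumes "set (order S) \<subseteq> V" and "\<forall>k. members S k \<subseteq> V"
  shows "set (order (contract_step P t a S)) \<subseteq> V \<and> (\<forall>k. members (contract_step P t a S) k \<subseteq> V)"
  using assms
  by (cases "(P, t, a, S)" rule: contract_step.cases)
    (auto simp: next_epoch_def revoke_def Let_def)

lemma fold_contract_step_validators:
  assumes "set (order S) \<subseteq> V" and "\<forall>k. members S k \<subseteq> V"
  shows "set (order (fold (contract_step P t) as S)) \<subseteq> V \<and>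
    (\<forall>k. members (fold (contract_step P t) as S) k \<subseteq> V)"
  using assms
proof (induction as arbitrary: S)
  case (Cons a as)
  then show ?case
    using contract_step_validators[OF Cons.prems] by simp
qed simp

lemma members_subset_validators: "members (contract_at P X t) k \<subseteq> validators P"
proof -
  have "set (order (contract_before P X t)) \<subseteq> validators P \<and>
      (\<forall>k. members (contract_before P X t) k \<subseteq> validators P)" for t
    by (induction t) (simp_all add: initial_contract_def fold_contract_step_validators)
  then show ?thesis
    by (simp add: contract_at_def del: contract_before.simps)
qed

lemma recorded_challenged_withdrawn:
  assumes "recorded k cp S" and "epoch S = k + 1" and "\<not> valid_checkpoint P S k cp"
  shows "withdrawn k (contract_step P t (p, Challenge k) S)"
  using assms by (auto simp: recorded_def withdrawn_def faulty_at_def revoke_def)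

lemma valid_checkpoint_evolves:
  assumes "evolves S S'" and "k \<le> epoch S"
  shows "valid_checkpoint P S' k cp \<longleftrightarrow> valid_checkpoint P S k cp"
  using evolves_members[OF assms] by (simp add: valid_checkpoint_def)

section \<open>Epochs\<close>

lemma opens_at_exists:
  assumes "k \<le> epoch_at P X t"
  obtains s where "s \<le> t" and "opens_at P X k s"
proof
  show "(LEAST s. k \<le> epoch_at P X s) \<le> t"
    using assms by (rule Least_le)
  show "opens_at P X k (LEAST s. k \<le> epoch_at P X s)"
    unfolding opens_at_def
    using LeastI[of "\<lambda>s. k \<le> epoch_at P X s", OF assms]
    by (auto dest: not_less_Least simp: not_le)
qed

lemma epoch_progress:
  assumes live: "mainchain_live P X" and rule: "timeout_rule P X"
  obtains u where "epoch_at P X t < epoch_at P X u"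
proof -
  have "\<exists>u. epoch_at P X t < epoch_at P X u"
  proof (rule ccontr)
    assume "\<nexists>u. epoch_at P X t < epoch_at P X u"
    then have const: "epoch_at P X u = epoch_at P X t" if "t \<le> u" for u
      using epoch_at_mono[OF that, of P X] by (metis le_neq_implies_less)
    define r where "r = timer_reset (contract_at P X t)"
    have timer: "timer_reset (contract_at P X u) = r" if "t \<le> u" for u
      using evolves_timer[OF evolves_contract_at[OF that, of P X]] const[OF that] by (simp add: r_def)
    define s where "s = max t (r + timeout P)"
    have "t \<le> s"
      by (simp add: s_def)
    have "timer_expired P s (contract_at P X s)"
      using timer[OF \<open>t \<le> s\<close>] by (simp add: timer_expired_def s_def)
    then have "due P X (epoch_at P X s) s (\<lambda>s'. \<exists>p. csends X s' p Timeout)"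
      using rule by (simp add: timeout_rule_def)
    then obtain s' where "s \<le> s'"
      and "(\<exists>p. csends X s' p Timeout) \<or> epoch_at P X s < epoch_at P X s'"
      unfolding due_def by blast
    then obtain p where "csends X s' p Timeout"
      using const[of s] const[of s'] \<open>t \<le> s\<close> by auto
    then obtain u where "s' < u" and u: "(p, Timeout) \<in> set (confirmed X u)"
      using live unfolding mainchain_live_def by blast
    obtain S where S: "evolves (contract_at P X s') S"
      and S': "evolves (contract_step P u (p, Timeout) S) (contract_at P X u)"
      using confirmed_executed[OF u \<open>s' < u\<close>] by blast
    have "t \<le> s'" "t \<le> u"
      using \<open>t \<le> s\<close> \<open>s \<le> s'\<close> \<open>s' < u\<close> by simp_all
    have "epoch S \<le> epoch_at P X u"
      using evolves_epoch[OF evolves_trans[OF evolves_contract_step S']] .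
    then have "epoch S = epoch_at P X s'"
      using evolves_epoch[OF S] const[OF \<open>t \<le> s'\<close>] const[OF \<open>t \<le> u\<close>] by simp
    then have "timer_reset S = r"
      using evolves_timer[OF S] timer[OF \<open>t \<le> s'\<close>] by simp
    then have "timer_expired P u S"
      using \<open>s \<le> s'\<close> \<open>s' < u\<close> by (simp add: timer_expired_def s_def)
    then have "epoch S < epoch (contract_step P u (p, Timeout) S)"
      by (simp add: next_epoch_def Let_def)
    also have "\<dots> \<le> epoch_at P X u"
      by (rule evolves_epoch[OF S'])
    finally show False
      using \<open>epoch S = epoch_at P X s'\<close> const[OF \<open>t \<le> s'\<close>] const[OF \<open>t \<le> u\<close>] by simp
  qed
  then show thesis
    using that by blast
qed

lemma submitted_recorded:
  assumes live: "mainchain_live P X" and sub: "submitted P X k cp"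
  obtains t s where "opens_at P X (k + 1) t"
    and "recorded k cp (contract_at P X t) \<or> withdrawn k (contract_at P X t)"
    and "csends X s (cp_leader cp) (Submit k (cp_block cp) (cp_cert cp))"
proof -
  obtain t i where i: "i < length (confirmed X t)"
    and nth: "confirmed X t ! i = (cp_leader cp, Submit k (cp_block cp) (cp_cert cp))"
    and within: "epoch (contract_within P X t i) = k" "leader (contract_within P X t i) = cp_leader cp"
    using sub unfolding submitted_def by blast
  let ?S = "contract_step P t (confirmed X t ! i) (contract_within P X t i)"
  have S: "recorded k cp ?S"
    using within by (simp add: nth recorded_def next_epoch_def Let_def)
  have ev: "evolves ?S (contract_at P X t)"
    by (rule nth_confirmed_executed[OF i])
  have "k + 1 \<le> epoch_at P X t"
    using S evolves_epoch[OF ev] by (simp add: recorded_def)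
  moreover have "epoch_at P X t' < k + 1" if "t' < t" for t'
    using evolves_epoch[OF contract_at_evolves_within[OF that]] within(1) by (metis less_Suc_eq_le Suc_eq_plus1)
  ultimately have "opens_at P X (k + 1) t"
    by (simp add: opens_at_def)
  moreover have "recorded k cp (contract_at P X t) \<or> withdrawn k (contract_at P X t)"
    using evolves_recorded[OF ev S] .
  moreover obtain s where
    "csends X s (cp_leader cp) (Submit k (cp_block cp) (cp_cert cp))"
    using live i nth unfolding mainchain_live_def by (metis nth_mem)
  ultimately show thesis
    using that by blast
qed

section \<open>Faulty and valid checkpoints\<close>

lemma faulty_checkpoint_withdrawn:
  assumes live: "mainchain_live P X" and rule: "challenge_rule P X"
    and adequate: "challenge_period_adequate P X" and p: "p \<in> honest P X"
    and opens: "opens_at P X (k + 1) t" and rec: "recorded k cp (contract_at P X t)"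
    and invalid: "\<not> valid_checkpoint P (contract_at P X t) k cp"
  obtains u where "epoch_at P X u = k + 1" and "withdrawn k (contract_at P X u)"
proof -
  let ?e = "t + check_delay P + confirm_delay P"
  have faulty: "faulty_at P (contract_at P X t) k"
    using rec invalid by (auto simp: faulty_at_def recorded_def)
  then have "epoch_at P X ?e = k + 1"
    using adequate opens by (simp add: challenge_period_adequate_def)
  moreover have "k + 1 \<le> epoch_at P X t"
    using opens by (simp add: opens_at_def)
  ultimately have ep: "epoch_at P X u = k + 1" if "t \<le> u" "u \<le> ?e" for u
    using epoch_at_mono[OF that(1), of P X] epoch_at_mono[OF that(2), of P X] by simp
  obtain s where s: "t \<le> s" "s \<le> t + check_delay P"
    and "csends X s p (Challenge k) \<or> statuses (contract_at P X s) k \<noteq> Unsettled"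
    using rule p opens faulty unfolding challenge_rule_def by blast
  moreover have recs: "recorded k cp (contract_at P X s) \<or> withdrawn k (contract_at P X s)"
    by (rule evolves_recorded[OF evolves_contract_at[OF s(1)] rec])
  moreover have eps: "epoch_at P X s = k + 1"
    using ep s by simp
  ultimately consider "withdrawn k (contract_at P X s)"
    | "recorded k cp (contract_at P X s)" "csends X s p (Challenge k)"
    by (auto simp: recorded_def)
  then show thesis
  proof cases
    case 1
    then show thesis
      using that eps by blast
  next
    case 2
    then obtain u where u: "s < u" "u \<le> s + confirm_delay P"
      and conf: "(p, Challenge k) \<in> set (confirmed X u)"
      using live unfolding mainchain_live_def by blast
    obtain S where S: "evolves (contract_at P X s) S"
      and S': "evolves (contract_step P u (p, Challenge k) S) (contract_at P X u)"
      using confirmed_executed[OF conf u(1)] by blast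
    have epu: "epoch_at P X u = k + 1"
      using ep s u by simp
    then have epS: "epoch S = k + 1"
      using evolves_epoch[OF S] evolves_epoch[OF evolves_trans[OF evolves_contract_step S']] eps
      by simp
    have tS: "evolves (contract_at P X t) S"
      by (rule evolves_trans[OF evolves_contract_at[OF s(1)] S])
    have "k \<le> epoch_at P X t"
      using rec by (simp add: recorded_def)
    then have "\<not> valid_checkpoint P S k cp"
      using valid_checkpoint_evolves[OF tS] invalid by blast
    then have "withdrawn k (contract_step P u (p, Challenge k) S)"
      using evolves_recorded[OF tS rec] recorded_challenged_withdrawn[OF _ epS]
        evolves_withdrawn[OF evolves_contract_step] by blast
    then show thesis
      using that[OF epu] evolves_withdrawn[OF S'] by blast
  qed
qed

lemma collected_quorum_cert: "collected P X t p V x c \<Longrightarrow> quorum_cert P V x c"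
  unfolding collected_def quorum_cert_def correct_aggregate_def authentic_def by metis

lemma honest_lock_committed:
  assumes net: "synchronous_network P X" and bc: "honest_broadcast P X"
    and lock: "lock_rule P X" and com: "commit_rule P X"
    and v: "v \<in> honest P X" and says: "says X t v (Lock k B)"
  obtains u where "commits X u v k B"
proof -
  obtain q m where m: "sends X t v q m" "body m = Lock k B"
    using says by (auto simp: says_def)
  obtain c where c: "carried m = Some c" "holds_qc P X t v k B c"
    using lock v m unfolding lock_rule_def by blast
  have val: "v \<in> validators P"
    using v by (simp add: honest_def)
  have snd: "sender m = v" "authentic P m" and "sends X t v v m"
    using bc v val m unfolding honest_broadcast_def by blast+
  then obtain u where u: "t \<le> u" "receives X u v m"
    using net val unfolding synchronous_network_def by blast
  have ep: "epoch_at P X t = k"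
    using c(2) by (simp add: holds_qc_def got_block_def)
  then have mem: "members (contract_at P X u) k = members (contract_at P X t) k"
    using evolves_members[OF evolves_contract_at[OF u(1), of P X], of k] by simp
  have "quorum_cert P (members (contract_at P X u) k) (Prepare k B) c"
    and "v \<in> members (contract_at P X u) k"
    using c(2) by (auto simp: holds_qc_def mem intro: collected_quorum_cert)
  moreover have "k \<le> epoch_at P X u"
    using epoch_at_mono[OF u(1), of P X] ep by simp
  ultimately have "correct_lock P (contract_at P X u) k B m"
    using snd m c(1) by (simp add: correct_lock_def)
  then show thesis
    using that com v u(2) unfolding commit_rule_def by blast
qed

lemma quorum_cert_honest_signer:
  assumes cert: "quorum_cert P V x c" and V: "V \<subseteq> validators P"
    and byz: "byzantine X \<subseteq> validators P" "card (byzantine X) \<le> faults P"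
  obtains v where "v \<in> signers c \<inter> honest P X"
proof -
  have "\<not> signers c \<subseteq> byzantine X"
  proof
    assume "signers c \<subseteq> byzantine X"
    moreover have "finite (byzantine X)"
      using byz(1) by (rule finite_subset) simp
    ultimately have "card (signers c) \<le> card (byzantine X)"
      by (rule card_mono[rotated])
    then show False
      using cert byz(2) by (simp add: quorum_cert_def)
  qed
  then show thesis
    using that cert V by (auto simp: quorum_cert_def honest_def)
qed

lemma valid_checkpoint_committed:
  assumes exec: "smart_bft_execution P X" and byz: "card (byzantine X) \<le> faults P"
    and sent: "csends X s p (Submit k (cp_block cp) (cp_cert cp))"
    and valid: "valid_checkpoint P (contract_at P X t) k cp"
  obtains v u where "v \<in> honest P X" and "commits X u v k (cp_block cp)"
proof -
  have cert: "quorum_cert P (members (contract_at P X t) k) (Lock k (cp_block cp)) (cp_cert cp)"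
    using valid by (simp add: valid_checkpoint_def)
  have "byzantine X \<subseteq> validators P"
    using exec by (simp add: smart_bft_execution_def)
  then obtain v where v: "v \<in> signers (cp_cert cp) \<inter> honest P X"
    using quorum_cert_honest_signer[OF cert members_subset_validators] byz by blast
  moreover have "unforgeable P X"
    using exec by (simp add: smart_bft_execution_def)
  moreover have "correct_aggregate P (signers (cp_cert cp)) (Lock k (cp_block cp)) (agg (cp_cert cp))"
    using cert by (simp add: quorum_cert_def)
  ultimately obtain s' where "says X s' v (Lock k (cp_block cp))"
    using sent unfolding unforgeable_def by blast
  then show thesis
    using that exec v honest_lock_committed[of P X v s' k "cp_block cp"]
    unfolding smart_bft_execution_def by blast
qed

lemma honest_exists:
  assumes "byzantine X \<subseteq> validators P" and "card (byzantine X) < card (validators P)"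
  obtains p where "p \<in> honest P X"
  using assms unfolding honest_def by (metis DiffI less_irrefl subsetI subset_antisym)

theorem theorem2:
  fixes P :: "('p, 'b, 's) params" and X :: "('p, 'b, 's) execution"
    and n f k :: nat and cp' :: "('p, 'b, 's) checkpoint" and B B' :: 'b
  assumes "smart_bft_execution P X"
    and "card (validators P) = n" and "faults P = f" and "n \<ge> 2 * f + 1"
    and "card (byzantine X) \<le> f"
    and "submitted P X k cp'" and "cp_block cp' = B'"
    and "\<forall>p\<in>honest P X. \<exists>t. commits X t p k B"
  shows "\<exists>t. ends_at P X (k + 1) t \<and>
           (revoked_at P X t k \<or> (settled_at P X t k cp' \<and> B' = B))"
proof -
  note exec = assms(1)[unfolded smart_bft_execution_def]
  have live: "mainchain_live P X"
    using exec by blast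
  obtain t s where opens: "opens_at P X (k + 1) t"
    and at_t: "recorded k cp' (contract_at P X t) \<or> withdrawn k (contract_at P X t)"
    and sent: "csends X s (cp_leader cp') (Submit k (cp_block cp') (cp_cert cp'))"
    using submitted_recorded[OF live assms(6)] by blast
  have k: "k + 1 \<le> epoch_at P X t"
    using opens by (simp add: opens_at_def)
  obtain u where "epoch_at P X t < epoch_at P X u"
    using epoch_progress[OF live] exec by blast
  then have "k + 2 \<le> epoch_at P X u"
    using k by simp
  then obtain e where e: "opens_at P X (k + 2) e"
    using opens_at_exists by blast
  then have ke: "k + 2 \<le> epoch_at P X e"
    by (simp add: opens_at_def)
  have "\<not> e < t"
    using opens ke by (auto simp: opens_at_def)
  then have te: "t \<le> e"
    by simp
  have at_e: "recorded k cp' (contract_at P X e) \<or> withdrawn k (contract_at P X e)"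
    using at_t evolves_recorded evolves_withdrawn evolves_contract_at[OF te] by blast
  have "withdrawn k (contract_at P X e) \<or> (recorded k cp' (contract_at P X e) \<and> B' = B)"
  proof (cases "recorded k cp' (contract_at P X t)")
    case False
    then show ?thesis
      using at_t evolves_withdrawn evolves_contract_at[OF te] by blast
  next
    case rec: True
    show ?thesis
    proof (cases "valid_checkpoint P (contract_at P X t) k cp'")
      case True
      obtain v u where "v \<in> honest P X" and "commits X u v k (cp_block cp')"
        using valid_checkpoint_committed[OF assms(1) _ sent True] assms(3,5) by auto
      moreover have "core_agreement P X"
        using exec by blast
      ultimately have "B' = B"
        using assms(7,8) unfolding core_agreement_def by metis
      then show ?thesis
        using at_e by blast
    next
      case False
      obtain p where p: "p \<in> honest P X"
        using honest_exists[of X P] exec assms(2,4,5) by auto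
      obtain w where w: "epoch_at P X w = k + 1" "withdrawn k (contract_at P X w)"
        using faulty_checkpoint_withdrawn[OF live _ _ p opens rec False] exec by blast
      have "w \<le> e"
        using epoch_at_mono[of e w P X] w(1) ke by linarith
      then show ?thesis
        using w(2) evolves_withdrawn evolves_contract_at by blast
    qed
  qed
  then have "revoked_at P X e k \<or> (settled_at P X e k cp' \<and> B' = B)"
    using ke by (auto simp: revoked_at_def settled_at_def withdrawn_def recorded_def)
  moreover have "ends_at P X (k + 1) e"
    using e by (simp add: ends_at_def)
  ultimately show ?thesis
    by blast
qed

end
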